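(* Let $F(t)=\sum_{j=0}^\infty b_jt^j$ be a power series with $b_0\in\{-1,1\}$ and $b_j\in\{-1,0,1\}$ for all $j\ge1$. Suppose that $F$ has a root at $\gamma\in[\gamma_{low},\gamma_{high}]$, where $0<\gamma_{low}\le\gamma_{high}$ and $\gamma_{high}=0.6491-\epsilon$ for some $\epsilon>0$. Let $\delta>0$ be such that $\delta$-transversality holds on the interval $[0,\gamma_{high}]$. Let $N$ be the smallest integer such that $\gamma^{N+1}\le\epsilon\,\delta\,(1-\gamma)$. Then for every integer $n\ge N$: (a) the polynomial $P_n(t)=\sum_{j=0}^{n}b_jt^j$ has a unique root $\gamma_n$ in $[0,0.6491]$; (b) any $\tilde\gamma\in[\gamma_{low},\gamma_{high}]$ which satisfies $|P_n(\tilde\gamma)|\le(\gamma_{low})^n$ also satisfies $|\tilde\gamma-\gamma|\le\tilde C\,|\gamma|^n$, where $\tilde C=\frac{1}{\delta(1-\gamma)}$.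
   Context: $\delta$-transversality: for $\rho\in(0,1)$ and $\delta>0$, $\delta$-transversality holds on $[0,\rho]$ if for every power series $g(x)=1+\sum_{j=1}^\infty a_jx^j$ with all $a_j\in\{-1,0,1\}$ and every $x\in[0,\rho]$, $g(x)<\delta$ implies $g'(x)<-\delta$. *)

theory Defs
  imports "HOL-Analysis.Analysis"
begin

definition power_series :: "(nat \<Rightarrow> real) \<Rightarrow> real \<Rightarrow> real" where
  "power_series a x = (\<Sum>j. a j * x ^ j)"

definition partial_poly :: "(nat \<Rightarrow> real) \<Rightarrow> nat \<Rightarrow> real \<Rightarrow> real" where
  "partial_poly a n x = (\<Sum>j\<le>n. a j * x ^ j)"

text \<open>Meaningful for \<open>0 < \<delta>\<close> and \<open>0 < \<rho> < 1\<close>: the series then converge in a neighbourhood of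
  every point of \<open>{0..\<rho>}\<close>, so the two-sided derivative exists there, also at \<open>0\<close>.\<close>

definition transversality :: "real \<Rightarrow> real \<Rightarrow> bool" where
  "transversality \<delta> \<rho> \<longleftrightarrow>
    (\<forall>a. a 0 = 1 \<and> (\<forall>j\<ge>1. a j \<in> {-1, 0, 1}) \<longrightarrow>
      (\<forall>x\<in>{0..\<rho>}. power_series a x < \<delta> \<longrightarrow> deriv (power_series a) x < - \<delta>))"

end

(* For a series g with constant term 1 and coefficients in [-1,1], the combination x g' - 4 g is
   largest for 1 - x - x^2 - x^3 + x^4 + x^5 + ..., and its value there is negative on [1/2, 0.6491].
   Hence g / x^4 decreases, and g has at most one root in [0, 0.6491].  For the truncation g = P_n
   of F this quantitative decay also yields existence: if 0 < P_n(\<gamma>) \<le> \<epsilon> \<delta>,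
   then P_n becomes nonpositive before 0.6491.  As \<delta> is only assumed on [0, \<gamma>_high], it has to
   be bounded above first, by testing transversality on explicit series.  Near 0.6491, where the
   extremal value tends to 0, one uses that the coefficients of P_n are integers: a small value
   P_n(\<gamma>) keeps them away from the extremal ones.
   Part (b) is the mean value inequality for P_n below the level \<delta>; if P_n exceeds
   \<delta> at the approximate root, then the claimed bound is at least 1. *)

theory Submission
  imports Defs
begin

section \<open>Power series with coefficients in [-1, 1]\<close>

lemma summable_bounded_coeffs:
  fixes c :: "nat \<Rightarrow> real"
  assumes "\<And>j. \<bar>c j\<bar> \<le> 1" "\<bar>x\<bar> < 1"
  shows "summable (\<lambda>j. c j * x ^ j)"
proof (rule summable_comparison_test')
  show "summable (\<lambda>j. \<bar>x\<bar> ^ j)"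
    using assms(2) by simp
  show "norm (c j * x ^ j) \<le> \<bar>x\<bar> ^ j" if "j \<ge> 0" for j
    using mult_right_mono[OF assms(1), of "\<bar>x\<bar> ^ j"] by (simp add: abs_mult power_abs)
qed

lemma power_series_sums:
  assumes "\<And>j. \<bar>c j\<bar> \<le> 1" "\<bar>x\<bar> < 1"
  shows "(\<lambda>j. c j * x ^ j) sums power_series c x"
  unfolding power_series_def using summable_bounded_coeffs[OF assms] by (rule summable_sums)

lemma power_series_deriv_sums:
  assumes c: "\<And>j. \<bar>c j\<bar> \<le> 1" and x: "\<bar>x\<bar> < 1"
  shows "(power_series c has_real_derivative deriv (power_series c) x) (at x)"
    and "(\<lambda>j. real j * c j * x ^ (j - 1)) sums deriv (power_series c) x"
proof -
  \<comment> \<open>Termwise differentiation at x asks for convergence at a point of larger modulus;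
    the midpoint of \<bar>x\<bar> and 1 is one.\<close>
  define r where "r = (1 + \<bar>x\<bar>) / 2"
  have r: "\<bar>x\<bar> < r" "\<bar>r\<bar> < 1" using x by (auto simp: r_def)
  have "((\<lambda>x. \<Sum>j. c j * x ^ j) has_real_derivative (\<Sum>j. diffs c j * x ^ j)) (at x)"
    using r by (intro termdiffs_strong[OF summable_bounded_coeffs[where c = c, OF c r(2)]]) auto
  moreover have "(\<lambda>x. \<Sum>j. c j * x ^ j) = power_series c"
    by (simp add: power_series_def fun_eq_iff)
  ultimately have D: "(power_series c has_real_derivative (\<Sum>j. diffs c j * x ^ j)) (at x)"
    by simp
  then have e: "deriv (power_series c) x = (\<Sum>j. diffs c j * x ^ j)"
    by (rule DERIV_imp_deriv)
  show "(power_series c has_real_derivative deriv (power_series c) x) (at x)"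
    using D e by simp
  have "summable (\<lambda>j. diffs c j * x ^ j)"
    using x by (intro termdiff_converges[where K = 1] summable_bounded_coeffs[OF c]) auto
  from diffs_equiv[OF this]
  show "(\<lambda>j. real j * c j * x ^ (j - 1)) sums deriv (power_series c) x"
    by (simp add: e)
qed

text \<open>The operator x d/dx - k is diagonal on monomials, with eigenvalue j - k on x^j, so it
  can be estimated one coefficient at a time.\<close>

lemma euler_operator_sums:
  assumes c: "\<And>j. \<bar>c j\<bar> \<le> 1" and x: "\<bar>x\<bar> < 1"
  shows "(\<lambda>j. (real j - k) * c j * x ^ j) sums
    (x * deriv (power_series c) x - k * power_series c x)"
proof -
  \<comment> \<open>At j = 0 the truncated exponent \<open>j - 1\<close> does no harm, as the factor
    \<open>real j\<close> vanishes.\<close>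
  have *: "x * (real j * c j * x ^ (j - 1)) - k * (c j * x ^ j) = (real j - k) * c j * x ^ j" for j
    by (cases j) (auto simp: algebra_simps)
  show ?thesis
    using sums_diff[OF sums_mult[OF power_series_deriv_sums(2)[where c = c, OF assms], of x]
        sums_mult[OF power_series_sums[where c = c, OF assms], of k]]
    unfolding * .
qed

text \<open>A geometric series dominates the terms from index n + 1 on. This controls P_n at a root
  of F, and with n = 0 it keeps roots away from 0.\<close>

lemma power_series_tail:
  assumes c: "\<And>j. \<bar>c j\<bar> \<le> 1" and x: "0 \<le> x" "x < 1"
  shows "\<bar>power_series c x - partial_poly c n x\<bar> \<le> x ^ (n + 1) / (1 - x)"
proof -
  have s: "summable (\<lambda>j. c j * x ^ j)" using x by (intro summable_bounded_coeffs c) auto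
  have "power_series c x - partial_poly c n x = (\<Sum>j. c (j + Suc n) * x ^ (j + Suc n))"
    using suminf_split_initial_segment[OF s, of "Suc n"]
    by (simp add: power_series_def partial_poly_def lessThan_Suc_atMost)
  moreover have "norm (\<Sum>j. c (j + Suc n) * x ^ (j + Suc n)) \<le> (\<Sum>j. x ^ (j + Suc n))"
  proof (rule norm_suminf_le)
    show "norm (c (j + Suc n) * x ^ (j + Suc n)) \<le> x ^ (j + Suc n)" for j
      using mult_right_mono[OF c, of "x ^ (j + Suc n)" "j + Suc n"] x
      by (simp add: abs_mult power_abs)
    show "summable (\<lambda>j. x ^ (j + Suc n))"
      using x by (intro summable_ignore_initial_segment summable_geometric) auto
  qed
  moreover have "(\<lambda>j. x ^ j * x ^ Suc n) sums (1 / (1 - x) * x ^ Suc n)"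
    using x by (intro sums_mult2 geometric_sums) auto
  then have "(\<Sum>j. x ^ (j + Suc n)) = x ^ (n + 1) / (1 - x)"
    unfolding power_add[symmetric] by (simp add: sums_unique[symmetric])
  ultimately show ?thesis by simp
qed

text \<open>At a root the constant term 1 is cancelled by the remaining terms, which amount to at
  most x / (1 - x).\<close>

lemma power_series_root_ge_half:
  assumes c: "\<And>j. \<bar>c j\<bar> \<le> 1" "c 0 = 1" and x: "0 \<le> x" "x < 1" and root: "power_series c x = 0"
  shows "1/2 \<le> x"
proof -
  have "1 \<le> x / (1 - x)"
    using power_series_tail[where c = c and n = 0, OF c(1) x] c root by (simp add: partial_poly_def)
  then show ?thesis using x by (simp add: field_simps)
qed

text \<open>Truncation stays within the class of series considered, so all estimates for series
  apply to P_n.\<close>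

lemma partial_poly_eq_power_series:
  "partial_poly b n = power_series (\<lambda>j. if j \<le> n then b j else 0)"
proof
  fix x
  have "power_series (\<lambda>j. if j \<le> n then b j else 0) x
      = (\<Sum>j\<in>{..n}. (if j \<le> n then b j else 0) * x ^ j)"
    unfolding power_series_def by (intro suminf_finite) auto
  then show "partial_poly b n x = power_series (\<lambda>j. if j \<le> n then b j else 0) x"
    by (simp add: partial_poly_def)
qed

text \<open>Such a series differs from the geometric one by a polynomial of degree at most 3; the
  closed forms can be evaluated at rational points.\<close>

lemma power_series_eventually_one:
  assumes a: "\<And>j. j \<ge> 4 \<Longrightarrow> a j = 1" and b: "\<And>j. \<bar>a j\<bar> \<le> 1" and x: "\<bar>x\<bar> < 1"
  shows "power_series a x = 1 / (1 - x) + (a 0 - 1) + (a 1 - 1) * x + (a 2 - 1) * x^2 + (a 3 - 1) * x^3"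
    and "deriv (power_series a) x = 1 / (1 - x)^2 + (a 1 - 1) + 2 * (a 2 - 1) * x + 3 * (a 3 - 1) * x^2"
proof -
  let ?f = "\<lambda>x. 1 / (1 - x) + (a 0 - 1) + (a 1 - 1) * x + (a 2 - 1) * x^2 + (a 3 - 1) * x^3"
  have eq: "power_series a y = ?f y" if y: "\<bar>y\<bar> < 1" for y
  proof -
    have "(\<lambda>j. a j * y ^ j - y ^ j) sums (\<Sum>j<4. a j * y ^ j - y ^ j)"
      by (rule sums_finite) (auto simp: a)
    from sums_add[OF geometric_sums[of y] this] y
    have "(\<lambda>j. a j * y ^ j) sums (1 / (1 - y) + (\<Sum>j<4. a j * y ^ j - y ^ j))"
      by simp
    then have "power_series a y = 1 / (1 - y) + (\<Sum>j<4. a j * y ^ j - y ^ j)"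
      unfolding power_series_def by (rule sums_unique[symmetric])
    then show ?thesis
      by (simp add: eval_nat_numeral algebra_simps)
  qed
  show "power_series a x = ?f x" using eq x .
  have D: "(?f has_real_derivative (1 / (1 - x)^2 + (a 1 - 1) + 2 * (a 2 - 1) * x + 3 * (a 3 - 1) * x^2)) (at x)"
    using x by (auto intro!: derivative_eq_intros simp: power2_eq_square field_simps)
  have "(power_series a has_real_derivative (1 / (1 - x)^2 + (a 1 - 1) + 2 * (a 2 - 1) * x + 3 * (a 3 - 1) * x^2)) (at x)"
  proof (rule has_field_derivative_transform_within_open[OF D])
    show "open {-1<..<1::real}" by simp
    show "x \<in> {-1<..<1}" using x by auto
    show "\<And>y. y \<in> {-1<..<1} \<Longrightarrow> ?f y = power_series a y" by (rule eq[symmetric]) auto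
  qed
  then show "deriv (power_series a) x = 1 / (1 - x)^2 + (a 1 - 1) + 2 * (a 2 - 1) * x + 3 * (a 3 - 1) * x^2"
    by (rule DERIV_imp_deriv)
qed

section \<open>The extremal series\<close>

definition star_coeffs :: "nat \<Rightarrow> real" where
  "star_coeffs j = (if 1 \<le> j \<and> j \<le> 3 then -1 else 1)"

lemma star_coeffs_simps [simp]:
  "star_coeffs 0 = 1" "star_coeffs (Suc 0) = -1" "star_coeffs 2 = -1" "star_coeffs 3 = -1"
  "j \<ge> 4 \<Longrightarrow> star_coeffs j = 1" "\<bar>star_coeffs j\<bar> \<le> 1"
  by (auto simp: star_coeffs_def)

lemma star_series:
  assumes "\<bar>x\<bar> < 1"
  shows "power_series star_coeffs x = 1 / (1 - x) - 2 * x - 2 * x^2 - 2 * x^3"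
    and "deriv (power_series star_coeffs) x = 1 / (1 - x)^2 - 2 - 4 * x - 6 * x^2"
  using power_series_eventually_one[of star_coeffs x] assms by simp_all

text \<open>The value of x g' - 4 g at the extremal series, simplified by x / (1 - x)^2 = 1 / (1 -
  x)^2 - 1 / (1 - x).\<close>

definition star_bound :: "real \<Rightarrow> real" where
  "star_bound x = 1 / (1 - x)^2 - 5 / (1 - x) + 6 * x + 4 * x^2 + 2 * x^3"

lemma star_bound_eq:
  assumes "\<bar>x\<bar> < 1"
  shows "star_bound x = x * deriv (power_series star_coeffs) x - 4 * power_series star_coeffs x"
proof -
  have "x * (1 / (1 - x)^2) = 1 / (1 - x)^2 - 1 / (1 - x)"
    using assms by (simp add: divide_simps power2_eq_square)
  then show ?thesis unfolding star_series[OF assms] star_bound_def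
    by (simp add: algebra_simps power2_eq_square power3_eq_cube)
qed

text \<open>For every coefficient the sign of \<open>j - 4\<close> decides which of \<open>-1\<close>, \<open>1\<close> is extremal for the
  operator \<open>x g' - 4 g\<close>; the coefficient of index \<open>4\<close> does not enter at all.\<close>

lemma star_defect_sums:
  assumes c: "\<And>j. \<bar>c j\<bar> \<le> 1" and x: "0 \<le> x" "x < 1"
  shows "(\<lambda>j. (real j - 4) * (star_coeffs j - c j) * x ^ j) sums
    (star_bound x - (x * deriv (power_series c) x - 4 * power_series c x))"
proof -
  have x': "\<bar>x\<bar> < 1" using x by simp
  show ?thesis
    using sums_diff[OF euler_operator_sums[of star_coeffs x 4, OF _ x']
        euler_operator_sums[of c x 4, OF c x']]
    unfolding star_bound_eq[OF x'] by (simp add: algebra_simps)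
qed

lemma star_defect_nonneg:
  assumes c: "\<bar>c j\<bar> \<le> 1" "c 0 = 1" and x: "0 \<le> x"
  shows "0 \<le> (real j - 4) * (star_coeffs j - c j) * x ^ j"
proof -
  consider "j = 0" | "1 \<le> j" "j \<le> 3" | "4 \<le> j" by linarith
  then have "0 \<le> (real j - 4) * (star_coeffs j - c j)"
  proof cases
    case 2
    then show ?thesis using c by (intro mult_nonpos_nonpos) (auto simp: star_coeffs_def)
  next
    case 3
    then show ?thesis using c by (intro mult_nonneg_nonneg) (auto simp: star_coeffs_def)
  qed (use c in simp)
  then show ?thesis using x by simp
qed

lemma euler_operator_le_star_bound:
  assumes c: "\<And>j. \<bar>c j\<bar> \<le> 1" "c 0 = 1" and x: "0 \<le> x" "x < 1"
  shows "x * deriv (power_series c) x - 4 * power_series c x \<le> star_bound x"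
  using sums_le[OF _ sums_zero star_defect_sums[where c = c, OF c(1) x]] star_defect_nonneg[of c, OF c x(1)]
  by simp

lemma has_real_derivative_inverse_power_one_minus:
  fixes x k :: real
  assumes "x \<noteq> 1"
  shows "((\<lambda>x. k / (1 - x) ^ n) has_real_derivative (k * real n / (1 - x) ^ Suc n)) (at x)"
proof -
  have "((\<lambda>x. inverse (1 - x)) has_real_derivative inverse (1 - x) ^ 2) (at x)"
    using assms by (auto intro!: derivative_eq_intros simp: power2_eq_square)
  from DERIV_cmult[OF DERIV_power[OF this, of n], of k] show ?thesis
    by (cases n) (simp_all add: divide_inverse power_inverse power2_eq_square mult_ac)
qed

text \<open>By convexity \<open>star_bound\<close> lies below its chord, which is -1.75 at 1/2 and
  at most -0.0005 at 0.6491. The slope 1.7495 / 0.1491 is rounded down to 11.7.\<close>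

lemma star_bound_chord:
  assumes x: "x \<in> {1/2..0.6491}"
  shows "star_bound x \<le> -11.7 * (0.6491 - x) - 0.0005"
proof -
  have "convex_on {1/2..0.6491} star_bound"
  proof (rule f''_ge0_imp_convex)
    fix y :: real assume y: "y \<in> {1/2..0.6491}"
    have y': "y \<noteq> 1" using y by auto
    have "((\<lambda>y. (1 / (1 - y)^2 - 5 / (1 - y)^1) + (6 * y + 4 * y^2 + 2 * y^3)) has_real_derivative
        (1 * real 2 / (1 - y)^Suc 2 - 5 * real 1 / (1 - y)^Suc 1) + (6 + 8 * y + 6 * y^2)) (at y)"
      by (intro DERIV_add[OF DERIV_diff] has_real_derivative_inverse_power_one_minus y')
        (auto intro!: derivative_eq_intros)
    then show "(star_bound has_real_derivative (2 / (1 - y)^3 - 5 / (1 - y)^2 + 6 + 8 * y + 6 * y^2)) (at y)"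
      unfolding star_bound_def[abs_def] by (simp add: eval_nat_numeral add.assoc)
    have "((\<lambda>y. (2 / (1 - y)^3 - 5 / (1 - y)^2) + (6 + 8 * y + 6 * y^2)) has_real_derivative
        (2 * real 3 / (1 - y)^Suc 3 - 5 * real 2 / (1 - y)^Suc 2) + (8 + 12 * y)) (at y)"
      by (intro DERIV_add[OF DERIV_diff] has_real_derivative_inverse_power_one_minus y')
        (auto intro!: derivative_eq_intros)
    then show "((\<lambda>y. 2 / (1 - y)^3 - 5 / (1 - y)^2 + 6 + 8 * y + 6 * y^2) has_real_derivative
        (6 / (1 - y)^4 - 10 / (1 - y)^3 + 8 + 12 * y)) (at y)"
      by (simp add: eval_nat_numeral add.assoc)
    \<comment> \<open>The negative term of the second derivative is absorbed, because
      \<open>6 - 10 * (1 - y)\<close> is at least 1 for y \<ge> 1/2.\<close>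
    have "6 / (1 - y)^4 - 10 / (1 - y)^3 = (6 - 10 * (1 - y)) / (1 - y)^4"
      using y' by (simp add: diff_divide_distrib[of 6] power_add[of _ 3 1, simplified] del: right_diff_distrib_numeral)
    moreover have "0 \<le> (6 - 10 * (1 - y)) / (1 - y)^4" using y by simp
    ultimately show "0 \<le> 6 / (1 - y)^4 - 10 / (1 - y)^3 + 8 + 12 * y" using y by simp
  qed simp
  from convex_onD_Icc'[OF this x]
  have "star_bound x \<le> (star_bound 0.6491 - star_bound (1/2)) / 0.1491 * (x - 1/2) + star_bound (1/2)"
    by simp
  moreover have half: "star_bound (1/2) = -1.75"
    by (simp add: star_bound_def power_divide field_simps)
  moreover have "star_bound 0.6491 \<le> -0.0005"
    by (simp add: star_bound_def power_divide field_simps)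
  then have "(star_bound 0.6491 - star_bound (1/2)) / 0.1491 * (x - 1/2) \<le> 1.7495 / 0.1491 * (x - 1/2)"
    using x half by (intro mult_right_mono divide_right_mono) auto
  ultimately have "star_bound x \<le> 1.7495 / 0.1491 * (x - 1/2) - 1.75" by linarith
  also have "\<dots> \<le> -11.7 * (0.6491 - x) - 0.0005" using x by (simp add: field_simps)
  finally show ?thesis .
qed

lemma star_bound_neg:
  assumes x: "x \<in> {1/2..0.6491}"
  shows "star_bound x \<le> -0.0005"
proof -
  have "-11.7 * (0.6491 - x) \<le> 0" using x by (intro mult_nonpos_nonneg) auto
  then show ?thesis using star_bound_chord[OF x] by linarith
qed

section \<open>Comparison with x^4 and uniqueness of the root\<close>

text \<open>The derivative of \<open>f x / x ^ 4\<close> is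
  \<open>(x * f' x - 4 * f x) / x ^ 5\<close>, so this quotient does not increase.\<close>

lemma euler_comparison:
  fixes f :: "real \<Rightarrow> real"
  assumes uv: "0 < u" "u \<le> v"
    and D: "\<And>x. x \<in> {u..v} \<Longrightarrow> (f has_real_derivative f' x) (at x)"
    and le: "\<And>x. x \<in> {u..v} \<Longrightarrow> x * f' x \<le> 4 * f x"
  shows "f v * u ^ 4 \<le> f u * v ^ 4"
proof -
  have "f v / v ^ 4 \<le> f u / u ^ 4"
  proof (rule DERIV_nonpos_imp_nonincreasing[OF uv(2)])
    fix x assume "u \<le> x" "x \<le> v"
    then have x: "x \<in> {u..v}" "x > 0" using uv by auto
    have "((\<lambda>x. f x / x ^ 4) has_real_derivative (x * f' x - 4 * f x) / x ^ 5) (at x)"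
      using x by (auto intro!: derivative_eq_intros D simp: divide_simps) (simp add: algebra_simps eval_nat_numeral)
    moreover have "(x * f' x - 4 * f x) / x ^ 5 \<le> 0"
      using le[OF x(1)] x by (simp add: divide_nonpos_pos)
    ultimately show "\<exists>y. ((\<lambda>x. f x / x ^ 4) has_real_derivative y) (at x) \<and> y \<le> 0" by blast
  qed
  then show ?thesis using uv by (simp add: field_simps)
qed

text \<open>The affine function q x = A + B x satisfies x q' - 4 q = - 4 A - 3 B x. Subtracting it
  turns an affine bound on the operator into the sign condition of
  \<open>euler_comparison\<close>.\<close>

lemma power_series_comparison:
  assumes c: "\<And>j. \<bar>c j\<bar> \<le> 1" and uv: "0 < u" "u \<le> v" "v < 1"
    and le: "\<And>x. x \<in> {u..v} \<Longrightarrow>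
      x * deriv (power_series c) x - 4 * power_series c x \<le> - 4 * A - 3 * B * x"
  shows "(power_series c v - (A + B * v)) * u ^ 4 \<le> (power_series c u - (A + B * u)) * v ^ 4"
proof (rule euler_comparison[OF uv(1,2)])
  fix x assume x: "x \<in> {u..v}"
  show "((\<lambda>x. power_series c x - (A + B * x)) has_real_derivative (deriv (power_series c) x - B)) (at x)"
    using x uv by (auto intro!: derivative_eq_intros power_series_deriv_sums(1)[where c = c, OF c])
  show "x * (deriv (power_series c) x - B) \<le> 4 * (power_series c x - (A + B * x))"
    using le[OF x] by (simp add: algebra_simps)
qed

lemma power_series_root_unique:
  assumes c: "\<And>j. \<bar>c j\<bar> \<le> 1" "c 0 = 1"
    and x: "x \<in> {0..0.6491}" "power_series c x = 0"
    and y: "y \<in> {0..0.6491}" "power_series c y = 0"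
  shows "x = y"
proof -
  have *: "\<not> u < v" if u: "u \<in> {0..0.6491}" "power_series c u = 0"
    and v: "v \<in> {0..0.6491}" "power_series c v = 0" for u v
  proof
    assume uv: "u < v"
    have h: "1/2 \<le> u" by (rule power_series_root_ge_half[where c = c, OF c]) (use u in auto)
    \<comment> \<open>Here 0.000125 = 0.0005 / 4 matches \<open>star_bound_neg\<close>. Both values
      of the series vanish, so what remains is v^4 \<le> u^4; a positive constant is essential for
      this.\<close>
    have "(power_series c v - (0.000125 + 0 * v)) * u ^ 4 \<le> (power_series c u - (0.000125 + 0 * u)) * v ^ 4"
    proof (rule power_series_comparison[OF c(1)])
      fix x assume x: "x \<in> {u..v}"
      then have "x \<in> {1/2..0.6491}" using h v by auto
      then show "x * deriv (power_series c) x - 4 * power_series c x \<le> - 4 * 0.000125 - 3 * 0 * x"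
        using euler_operator_le_star_bound[where c = c and x = x, OF c] star_bound_neg[of x] by auto
    qed (use h uv v in auto)
    then have "v ^ 4 \<le> u ^ 4" using u v by simp
    moreover have "u ^ 4 < v ^ 4" using uv h by (intro power_strict_mono) auto
    ultimately show False by simp
  qed
  then show ?thesis using x y by (meson linorder_neqE)
qed

section \<open>Upper bounds for \<delta> from test series\<close>

lemma transversality_mono:
  "transversality \<delta> \<rho> \<Longrightarrow> \<rho>' \<le> \<rho> \<Longrightarrow> transversality \<delta> \<rho>'"
  unfolding transversality_def by fastforce

text \<open>Each test series bounds \<delta>: if \<delta> exceeded K, the value at x would be below
  \<delta> while the derivative is at least -K > -\<delta>.\<close>

lemma transversality_delta_le:
  assumes "transversality \<delta> \<rho>" "0 \<le> x" "x \<le> \<rho>"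
    and "a 0 = 1" "\<And>j. j \<ge> 1 \<Longrightarrow> a j \<in> {-1, 0, 1}"
    and "power_series a x \<le> K" "- deriv (power_series a) x \<le> K"
  shows "\<delta> \<le> K"
proof (rule ccontr)
  assume "\<not> \<delta> \<le> K"
  then have "power_series a x < \<delta>" using assms(6) by simp
  then have "deriv (power_series a) x < - \<delta>"
    using assms(1-5) unfolding transversality_def by simp
  then show False using assms(7) \<open>\<not> \<delta> \<le> K\<close> by simp
qed

text \<open>Each bound is the larger of value and negated derivative at the test point, rounded up:
  the derivative decides at 1/2 and 0.606, the value at 0.55. The test series is 1 - x - x^2 + x^4 +
  x^5 + ... at the first two points and the extremal one at 0.606.\<close>

lemma transversality_delta_bounds:
  assumes t: "transversality \<delta> \<rho>"
  shows "1/2 \<le> \<rho> \<Longrightarrow> \<delta> \<le> 0.75"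
    and "0.55 \<le> \<rho> \<Longrightarrow> \<delta> \<le> 0.351"
    and "0.606 \<le> \<rho> \<Longrightarrow> \<delta> \<le> 0.186"
proof -
  define a :: "nat \<Rightarrow> real" where "a = star_coeffs(3 := 0)"
  have a: "a 0 = 1" "a j \<in> {-1, 0, 1}" "j \<ge> 4 \<Longrightarrow> a j = 1" "\<bar>a j\<bar> \<le> 1" for j
    by (auto simp: a_def star_coeffs_def)
  have a': "power_series a x = 1 / (1 - x) - 2 * x - 2 * x^2 - x^3"
     "deriv (power_series a) x = 1 / (1 - x)^2 - 2 - 4 * x - 3 * x^2" if "\<bar>x\<bar> < 1" for x
    using power_series_eventually_one[of a x, OF a(3,4) that] by (simp_all add: a_def)
  show "\<delta> \<le> 0.75" if "1/2 \<le> \<rho>"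
    by (rule transversality_delta_le[OF t _ that, of a]) (use a in \<open>simp_all add: a' power_divide\<close>)
  show "\<delta> \<le> 0.351" if "0.55 \<le> \<rho>"
    by (rule transversality_delta_le[OF t _ that, of a]) (use a in \<open>simp_all add: a' power_divide\<close>)
  show "\<delta> \<le> 0.186" if "0.606 \<le> \<rho>"
    by (rule transversality_delta_le[OF t _ that, of star_coeffs])
      (simp_all add: star_series power_divide, simp add: star_coeffs_def)
qed


section \<open>Nonpositivity of truncations at 0.6491\<close>

text \<open>As \<open>star_bound\<close> is only known to be nonpositive here, the gain of 0.14
  comes from the defect \<open>d\<close>: either an early coefficient is not extremal, or the gap
  between the extremal value and the small value at \<gamma> has to come from later
  coefficients.\<close>

lemma euler_operator_le_near_root:
  assumes c: "\<And>j. c j \<in> {-1, 0, 1}" "c 0 = 1"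
    and \<gamma>: "0.625 \<le> \<gamma>" "\<gamma> \<le> x" "x \<le> 0.6491"
    and p: "0 < power_series c \<gamma>" "power_series c \<gamma> \<le> 0.005"
  shows "x * deriv (power_series c) x - 4 * power_series c x \<le> - 0.14"
proof -
  have c1: "\<bar>c j\<bar> \<le> 1" for j using c(1)[of j] by auto
  define d where "d j = (real j - 4) * (star_coeffs j - c j)" for j
  have d0: "0 \<le> d j" for j
    using star_defect_nonneg[of c j 1] c1 c(2) by (simp add: d_def)
  have dx: "(\<lambda>j. d j * y ^ j) sums (star_bound y - (y * deriv (power_series c) y - 4 * power_series c y))"
    if "0 \<le> y" "y < 1" for y
    unfolding d_def by (rule star_defect_sums[OF c1 that])
  have xb: "0 \<le> x" "x < 1" "star_bound x \<le> 0" using \<gamma> star_bound_neg[of x] by auto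
  have \<gamma>1: "\<bar>\<gamma>\<bar> < 1" using \<gamma> by auto
  have "0.14 \<le> star_bound x - (x * deriv (power_series c) x - 4 * power_series c x)"
  proof (cases "c 1 = -1 \<and> c 2 = -1 \<and> c 3 = -1")
    case False
    \<comment> \<open>By integrality c_i \<ge> 0, so the single defect term of index i has
      coefficient at least 1 and suffices.\<close>
    then obtain i where i: "i \<in> {1, 2, 3}" "c i \<noteq> -1" by auto
    then have "1 \<le> d i" using c(1)[of i] by (auto simp: d_def)
    have "0.14 \<le> (0.625::real) ^ 3" by (simp add: power_divide)
    also have "\<dots> \<le> x ^ 3" using \<gamma> by (intro power_mono) auto
    also have "\<dots> \<le> x ^ i" using i xb by (intro power_decreasing) auto
    also have "\<dots> \<le> d i * x ^ i" using \<open>1 \<le> d i\<close> xb mult_right_mono[of 1 "d i" "x ^ i"] by simp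
    also have "\<dots> = (\<Sum>j\<in>{i}. d j * x ^ j)" by simp
    also have "\<dots> \<le> (\<Sum>j. d j * x ^ j)"
      using dx[OF xb(1,2)] d0 xb by (intro sum_le_suminf) (auto dest: sums_summable)
    also have "\<dots> = star_bound x - (x * deriv (power_series c) x - 4 * power_series c x)"
      using dx[OF xb(1,2)] by (rule sums_unique[symmetric])
    finally show ?thesis .
  next
    case True
    have diff: "(\<lambda>j. (star_coeffs j - c j) * \<gamma> ^ j) sums (power_series star_coeffs \<gamma> - power_series c \<gamma>)"
      using sums_diff[OF power_series_sums[of star_coeffs, OF _ \<gamma>1] power_series_sums[of c, OF c1 \<gamma>1]]
      by (simp add: algebra_simps)
    have head: "star_coeffs j = c j" if "j < 4" for j
    proof -
      have "j \<in> {0, 1, 2, 3}" using that by auto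
      then show ?thesis using True c(2) by auto
    qed
    \<comment> \<open>For j \<ge> 5 the weight j - 4 is at least 1 and \<gamma> \<le> x. Index 4 has
      weight 0 and is left out of the gap.\<close>
    have "d j * x ^ j \<ge> (if j = 4 then 0 else (star_coeffs j - c j) * \<gamma> ^ j)" for j
    proof (cases "j \<ge> 5")
      case True
      then have "0 \<le> star_coeffs j - c j" using c1[of j] by simp
      moreover from this True have "star_coeffs j - c j \<le> d j"
        unfolding d_def using mult_right_mono[of 1 "real j - 4" "star_coeffs j - c j"] by simp
      moreover have "\<gamma> ^ j \<le> x ^ j" using \<gamma> by (intro power_mono) auto
      ultimately show ?thesis using True \<gamma> by (auto intro!: mult_mono)
    next
      case False
      then show ?thesis using head[of j] d0[of j] xb by (cases "j = 4") auto
    qed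
    moreover have "(\<lambda>j. if j = 4 then 0 else (star_coeffs j - c j) * \<gamma> ^ j) sums
        (power_series star_coeffs \<gamma> - power_series c \<gamma> - (1 - c 4) * \<gamma> ^ 4)"
    proof -
      have "(\<lambda>j. if j = 4 then (star_coeffs j - c j) * \<gamma> ^ j else 0) sums ((star_coeffs 4 - c 4) * \<gamma> ^ 4)"
        by (rule sums_single)
      from sums_diff[OF diff this] show ?thesis
        by (simp add: if_distrib[of "\<lambda>t. _ - t"] cong: if_cong)
    qed
    ultimately have le: "power_series star_coeffs \<gamma> - power_series c \<gamma> - (1 - c 4) * \<gamma> ^ 4
        \<le> star_bound x - (x * deriv (power_series c) x - 4 * power_series c x)"
      by (rule sums_le[OF _ _ dx[OF xb(1,2)]])
    \<comment> \<open>Centring at \<gamma> = 5/8 makes t small and nonnegative, so its higher powers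
      have linear bounds and the polynomial inequalities in \<gamma> become linear.\<close>
    define t where "t = 8 * \<gamma> - 5"
    have t: "0 \<le> t" "t \<le> 1/5" and \<gamma>_eq: "\<gamma> = (t + 5) / 8" using \<gamma> by (auto simp: t_def)
    have tp: "0 \<le> t ^ k" "t ^ Suc k \<le> (1/5) ^ k * t" for k
      using t mult_right_mono[OF power_mono[of t "1/5" k], of t] by (auto simp: mult.commute)
    have e4: "4096 * \<gamma> ^ 4 = t ^ 4 + 20 * t ^ 3 + 150 * t ^ 2 + 500 * t + 625"
      and e5: "32768 * \<gamma> ^ 5 = t ^ 5 + 25 * t ^ 4 + 250 * t ^ 3 + 1250 * t ^ 2 + 3125 * t + 3125"
      unfolding \<gamma>_eq power_divide by (simp_all add: algebra_simps eval_nat_numeral)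
    have tu: "t ^ 2 \<le> 1/5 * t" "t ^ 3 \<le> 1/25 * t" "t ^ 4 \<le> 1/125 * t" "t ^ 5 \<le> 1/625 * t"
      using tp(2)[of 1] tp(2)[of 2] tp(2)[of 3] tp(2)[of 4] by (simp_all add: eval_nat_numeral)
    have star: "(1 - \<gamma>) * power_series star_coeffs \<gamma> = 1 - 2 * \<gamma> + 2 * \<gamma> ^ 4"
      unfolding star_series[OF \<gamma>1] using \<gamma>1
      by (simp add: right_diff_distrib) (simp add: algebra_simps eval_nat_numeral)
    \<comment> \<open>Otherwise c_4 \<le> 0, and positivity at \<gamma> forces the extremal value
      above \<gamma>^4, that is, 0 < 1 - 2 \<gamma> + \<gamma>^4 + \<gamma>^5, which fails in this
      range.\<close>
    have "c 4 = 1"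
    proof (rule ccontr)
      assume "c 4 \<noteq> 1"
      then have "0 \<le> - c 4 * \<gamma> ^ 4" using c(1)[of 4] \<gamma> by auto
      moreover have "0 \<le> power_series star_coeffs \<gamma> - power_series c \<gamma> - (1 - c 4) * \<gamma> ^ 4"
      proof (rule sums_le[OF _ sums_zero])
        show "(\<lambda>j. if j = 4 then 0 else (star_coeffs j - c j) * \<gamma> ^ j) sums
          (power_series star_coeffs \<gamma> - power_series c \<gamma> - (1 - c 4) * \<gamma> ^ 4)" by fact
        show "0 \<le> (if j = 4 then 0 else (star_coeffs j - c j) * \<gamma> ^ j)" for j
          using head[of j] c1[of j] \<gamma> by (cases "j < 4") auto
      qed
      ultimately have "\<gamma> ^ 4 < power_series star_coeffs \<gamma>" using p by (simp add: algebra_simps)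
      then have "(1 - \<gamma>) * \<gamma> ^ 4 < 1 - 2 * \<gamma> + 2 * \<gamma> ^ 4"
        unfolding star[symmetric] using \<gamma>1 by (intro mult_strict_left_mono) auto
      then have "0 < 1 - 2 * \<gamma> + \<gamma> ^ 4 + \<gamma> ^ 5" by (simp add: algebra_simps eval_nat_numeral)
      moreover have "1 - 2 * \<gamma> + \<gamma> ^ 4 + \<gamma> ^ 5 \<le> 0"
        using t tu e4 e5 t_def by linarith
      ultimately show False by simp
    qed
    \<comment> \<open>Subtracting the value at \<gamma>, at most 0.005, leaves 0.14. The quartic
      below is 200 (1 - \<gamma>) times the extremal value minus 0.145.\<close>
    moreover have "0.145 \<le> power_series star_coeffs \<gamma>"
    proof -
      have "500 * t + 625 \<le> 4096 * \<gamma> ^ 4"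
        unfolding e4 using tp(1)[of 2] tp(1)[of 3] tp(1)[of 4] by linarith
      then have "0 \<le> 171 - 371 * \<gamma> + 400 * \<gamma> ^ 4"
        using t t_def by linarith
      then have "(1 - \<gamma>) * 0.145 \<le> (1 - \<gamma>) * power_series star_coeffs \<gamma>" unfolding star by (simp add: field_simps)
      then show ?thesis using \<gamma>1 by (subst (asm) mult_le_cancel_left_pos) auto
    qed
    ultimately show ?thesis using le p by simp
  qed
  then show ?thesis using xb by simp
qed


text \<open>After comparison between \<gamma> and 0.6491 and scaling by r = \<gamma> / 0.6491, a
  factor 1 - r cancels against 0.6491 - \<gamma>, and only an upper bound on \<delta> is left to
  check.\<close>

lemma power_series_nonpos_at_end:
  assumes c: "\<And>j. c j \<in> {-1, 0, 1}" "c 0 = 1"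
    and t: "transversality \<delta> \<gamma>" and \<gamma>: "1/2 \<le> \<gamma>" "\<gamma> < 0.6491"
    and p: "0 < power_series c \<gamma>" "power_series c \<gamma> \<le> (0.6491 - \<gamma>) * \<delta>"
  shows "power_series c 0.6491 \<le> 0"
proof -
  have c1: "\<bar>c j\<bar> \<le> 1" for j using c(1)[of j] by auto
  define r where "r = \<gamma> / 0.6491"
  have r: "0 < r" "r < 1" and \<gamma>_eq: "\<gamma> = 0.6491 * r" using \<gamma> by (auto simp: r_def)
  have p': "power_series c \<gamma> \<le> 0.6491 * (1 - r) * \<delta>"
    using p(2) by (simp add: \<gamma>_eq algebra_simps)
  note \<delta> = transversality_delta_bounds[OF t]
  show ?thesis
  proof (cases "\<gamma> \<le> 0.625")
    case True
    \<comment> \<open>\<open>q x = 11.7 * 0.6491 / 4 - 3.9 * x\<close> solves \<open>x q' - 4 q = -11.7 * (0.6491 - x)\<close>, the chord bound.\<close>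
    have "(power_series c 0.6491 - (11.7 * 0.6491 / 4 + - 3.9 * 0.6491)) * \<gamma> ^ 4
        \<le> (power_series c \<gamma> - (11.7 * 0.6491 / 4 + - 3.9 * \<gamma>)) * 0.6491 ^ 4"
    proof (rule power_series_comparison[OF c1])
      fix x assume "x \<in> {\<gamma>..0.6491}"
      then have x: "x \<in> {1/2..0.6491}" using \<gamma> by auto
      have "x * deriv (power_series c) x - 4 * power_series c x \<le> star_bound x"
        using x by (intro euler_operator_le_star_bound c1 c) auto
      also have "\<dots> \<le> -11.7 * (0.6491 - x)"
        by (rule order_trans[OF star_bound_chord[OF x]]) simp
      also have "\<dots> = - 4 * (11.7 * 0.6491 / 4) - 3 * (- 3.9) * x"
        by (simp add: field_simps)
      finally show "x * deriv (power_series c) x - 4 * power_series c x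
          \<le> - 4 * (11.7 * 0.6491 / 4) - 3 * (- 3.9) * x" .
    qed (use \<gamma> in auto)
    then have "(power_series c 0.6491 + 11.7 * 0.6491 / 12) * r ^ 4
        \<le> power_series c \<gamma> - (11.7 * 0.6491 / 4 - 3.9 * 0.6491 * r)"
      unfolding \<gamma>_eq power_mult_distrib by simp
    moreover have "power_series c \<gamma> \<le> 11.7 * 0.6491 / 12 * ((1 - r) * (3 - r - r^2 - r^3))"
    proof -
      have r3: "r^2 \<le> b^2" "r^3 \<le> b^3" if "r \<le> b" for b
        using r that by (auto intro!: power_mono)
      \<comment> \<open>The right-hand side decreases in r, so the upper ends 0.55, 0.606 and 0.625,
        divided by 0.6491 and rounded up, give the worst case in each range.\<close>
      consider "\<gamma> \<le> 0.55" | "0.55 \<le> \<gamma>" "\<gamma> \<le> 0.606" | "0.606 \<le> \<gamma>" by linarith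
      then have "\<delta> \<le> 11.7 / 12 * (3 - r - r^2 - r^3)"
      proof cases
        case 1
        then have "r \<le> 0.848" by (simp add: r_def)
        then show ?thesis using \<delta>(1) \<gamma> r3[of "0.848"] by (simp add: power_divide)
      next
        case 2
        then have "r \<le> 0.934" by (simp add: r_def)
        then show ?thesis using \<delta>(2) 2 r3[of "0.934"] by (simp add: power_divide)
      next
        case 3
        have "r \<le> 0.963" using True by (simp add: r_def)
        then show ?thesis using \<delta>(3) 3 r3[of "0.963"] by (simp add: power_divide)
      qed
      then have "0.6491 * (1 - r) * \<delta> \<le> 0.6491 * (1 - r) * (11.7 / 12 * (3 - r - r^2 - r^3))"
        using r by (intro mult_left_mono) auto
      also have "\<dots> = 11.7 * 0.6491 / 12 * ((1 - r) * (3 - r - r^2 - r^3))"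
        by (simp add: field_simps)
      finally show ?thesis using p' by (rule order_trans[rotated])
    qed
    moreover have "(1 - r) * (3 - r - r^2 - r^3) = 3 - 4 * r + r ^ 4"
      by (simp add: algebra_simps eval_nat_numeral)
    ultimately have "power_series c 0.6491 * r ^ 4 \<le> 0" by (simp add: field_simps)
    then show ?thesis using r by (simp add: mult_le_0_iff)
  next
    case False
    have "\<delta> \<le> 0.186" using \<delta>(3) False by simp
    have "0 < (0.6491 - \<gamma>) * \<delta>" using p by linarith
    then have "0 < \<delta>" using \<gamma> by (simp add: zero_less_mult_iff)
    have "(0.6491 - \<gamma>) * \<delta> \<le> 0.0241 * 0.186"
      using False \<gamma> \<open>\<delta> \<le> 0.186\<close> \<open>0 < \<delta>\<close> by (intro mult_mono) auto
    then have p5: "power_series c \<gamma> \<le> 0.005" using p(2) by simp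
    \<comment> \<open>The constant 0.035 is a quarter of the gain 0.14.\<close>
    have "(power_series c 0.6491 - (0.035 + 0 * 0.6491)) * \<gamma> ^ 4
        \<le> (power_series c \<gamma> - (0.035 + 0 * \<gamma>)) * 0.6491 ^ 4"
    proof (rule power_series_comparison[OF c1])
      fix x assume "x \<in> {\<gamma>..0.6491}"
      then show "x * deriv (power_series c) x - 4 * power_series c x \<le> - 4 * 0.035 - 3 * 0 * x"
        using euler_operator_le_near_root[of c, OF c _ _ _ p(1) p5, of x] False by simp
    qed (use \<gamma> in auto)
    then have "(power_series c 0.6491 - 0.035) * r ^ 4 \<le> power_series c \<gamma> - 0.035"
      unfolding \<gamma>_eq power_mult_distrib by simp
    moreover have "power_series c \<gamma> \<le> 0.035 * (1 - r ^ 4)"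
    proof -
      have "0.962 \<le> r" using False by (simp add: r_def)
      then have "0.962 ^ 2 \<le> r ^ 2" "0.962 ^ 3 \<le> r ^ 3" by (auto intro!: power_mono)
      then have "0.6491 * \<delta> \<le> 0.035 * (1 + r + r^2 + r^3)"
        using \<open>\<delta> \<le> 0.186\<close> \<open>0.962 \<le> r\<close> by (simp add: power_divide)
      then have "(1 - r) * (0.6491 * \<delta>) \<le> (1 - r) * (0.035 * (1 + r + r^2 + r^3))"
        using r by (intro mult_left_mono) auto
      also have "\<dots> = 0.035 * (1 - r ^ 4)" by (simp add: algebra_simps eval_nat_numeral)
      finally show ?thesis using p' by (simp only: mult_ac)
    qed
    ultimately have "power_series c 0.6491 * r ^ 4 \<le> 0" by (simp add: algebra_simps)
    then show ?thesis using r by (simp add: mult_le_0_iff)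
  qed
qed


section \<open>Decay under transversality, and the two claims\<close>

lemma power_series_uminus: "power_series (\<lambda>j. - a j) x = - power_series a x"
  if "\<And>j. \<bar>a j\<bar> \<le> 1" "\<bar>x\<bar> < 1"
  using suminf_minus[OF summable_bounded_coeffs[of a, OF that]] by (simp add: power_series_def)

text \<open>Once below \<delta>, the series has slope below -\<delta> and therefore never climbs
  back to \<delta>; the mean value inequality then holds on all of [u, v].\<close>

lemma transversality_decay:
  assumes t: "transversality \<delta> \<rho>" "0 < \<delta>" and \<rho>: "\<rho> < 1"
    and c: "\<And>j. c j \<in> {-1, 0, 1}" "c 0 = 1"
    and uv: "0 \<le> u" "u \<le> v" "v \<le> \<rho>" and small: "power_series c u < \<delta>"
  shows "power_series c v + \<delta> * (v - u) \<le> power_series c u"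
proof -
  have c1: "\<bar>c j\<bar> \<le> 1" for j using c(1)[of j] by auto
  have D: "(power_series c has_real_derivative deriv (power_series c) x) (at x)" if "x \<in> {u..v}" for x
    using that uv \<rho> by (intro power_series_deriv_sums(1) c1) auto
  have neg: "deriv (power_series c) x < - \<delta>" if "x \<in> {u..v}" "power_series c x < \<delta>" for x
    using t(1) that uv c unfolding transversality_def by auto
  have cont: "continuous_on {u..v} (power_series c)"
    by (intro continuous_at_imp_continuous_on ballI DERIV_isCont[OF D])
  have below: "power_series c x < \<delta>" if x: "x \<in> {u..v}" for x
  proof (rule ccontr)
    \<comment> \<open>The least point w of the compact set S would be reached from below \<delta>,
      yet the series decreases on [u, w].\<close>
    define S where "S = {y \<in> {u..v}. \<delta> \<le> power_series c y}"
    assume "\<not> power_series c x < \<delta>"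
    then have "S \<noteq> {}" using x by (auto simp: S_def)
    have "S = {u..v} \<inter> ({u..v} \<inter> power_series c -` {\<delta>..})" by (auto simp: S_def)
    moreover have "closed ({u..v} \<inter> power_series c -` {\<delta>..})"
      by (rule continuous_closed_preimage[OF cont]) simp_all
    then have "compact ({u..v} \<inter> ({u..v} \<inter> power_series c -` {\<delta>..}))"
      by (rule compact_Int_closed[OF compact_Icc])
    ultimately have "compact S" by simp
    from compact_attains_inf[OF this \<open>S \<noteq> {}\<close>]
    obtain w where w: "w \<in> S" "\<And>y. y \<in> S \<Longrightarrow> w \<le> y" by blast
    from w(1) have "u \<le> w" "w \<le> v" "\<delta> \<le> power_series c w"
      by (auto simp: S_def)
    moreover from this have "u \<noteq> w" using small by auto
    ultimately have "u < w" by simp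
    have "power_series c w < power_series c u"
    proof (rule DERIV_neg_imp_decreasing_open[OF \<open>u < w\<close>])
      fix y assume "u < y" "y < w"
      then have y: "y \<in> {u..v}" "power_series c y < \<delta>"
        using w(2)[of y] \<open>w \<le> v\<close> by (force simp: S_def)+
      show "\<exists>z. (power_series c has_real_derivative z) (at y) \<and> z < 0"
        using D[OF y(1)] neg[OF y] t(2) by (intro exI[of _ "deriv (power_series c) y"]) auto
    next
      show "continuous_on {u..w} (power_series c)"
        using cont by (rule continuous_on_subset) (use \<open>w \<le> v\<close> in auto)
    qed
    then show False using small \<open>\<delta> \<le> power_series c w\<close> by simp
  qed
  have "power_series c v + \<delta> * v \<le> power_series c u + \<delta> * u"
  proof (rule DERIV_nonpos_imp_nonincreasing[OF uv(2)])
    fix x assume "u \<le> x" "x \<le> v"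
    then have x: "x \<in> {u..v}" by simp
    show "\<exists>y. ((\<lambda>x. power_series c x + \<delta> * x) has_real_derivative y) (at x) \<and> y \<le> 0"
      using neg[OF x below[OF x]]
      by (intro exI[of _ "deriv (power_series c) x + \<delta>"]) (auto intro!: derivative_eq_intros D[OF x])
  qed
  then show ?thesis by (simp add: algebra_simps)
qed

text \<open>P_n is 1 at 0 and nonpositive at \<gamma> or at 0.6491, so the intermediate value
  theorem gives a root.\<close>

lemma partial_poly_root_unique_exists:
  fixes b :: "nat \<Rightarrow> real"
  assumes b: "b 0 = 1" "\<And>j. b j \<in> {-1, 0, 1}"
    and \<gamma>: "0 \<le> \<gamma>" "\<gamma> < 0.6491" and root: "power_series b \<gamma> = 0"
    and t: "transversality \<delta> \<gamma>"
    and small: "\<gamma> ^ (n + 1) \<le> (0.6491 - \<gamma>) * \<delta> * (1 - \<gamma>)"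
  shows "\<exists>!x. x \<in> {0..0.6491} \<and> partial_poly b n x = 0"
proof -
  have b1: "\<bar>b j\<bar> \<le> 1" for j using b(2)[of j] by auto
  define c where "c j = (if j \<le> n then b j else 0)" for j
  have c: "c j \<in> {-1, 0, 1}" "c 0 = 1" for j using b by (auto simp: c_def)
  have c1: "\<bar>c j\<bar> \<le> 1" for j using c(1)[of j] by auto
  have P: "partial_poly b n = power_series c"
    unfolding partial_poly_eq_power_series c_def ..
  have half: "1/2 \<le> \<gamma>"
    by (rule power_series_root_ge_half[of b]) (use b1 b(1) \<gamma> root in auto)
  have "\<gamma> ^ (n + 1) / (1 - \<gamma>) \<le> (0.6491 - \<gamma>) * \<delta>"
    using small \<gamma> by (subst pos_divide_le_eq) auto
  then have p: "power_series c \<gamma> \<le> (0.6491 - \<gamma>) * \<delta>"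
    using power_series_tail[of b, OF b1 \<gamma>(1), of n] \<gamma> root P by simp
  have "\<exists>v\<in>{0..0.6491}. power_series c v \<le> 0"
  proof (cases "power_series c \<gamma> \<le> 0")
    case True
    then show ?thesis using \<gamma> by auto
  next
    case False
    then show ?thesis
      using power_series_nonpos_at_end[of c, OF c t half \<gamma>(2) _ p] by (intro bexI[of _ "0.6491"]) auto
  qed
  then obtain v where v: "0 \<le> v" "v \<le> 0.6491" "power_series c v \<le> 0" by auto
  have "power_series c 0 = 1" using c(2) by (simp add: power_series_def)
  moreover have "isCont (power_series c) x" if "0 \<le> x \<and> x \<le> v" for x
    using that v by (intro DERIV_isCont[OF power_series_deriv_sums(1)] c1) auto
  ultimately obtain x where "0 \<le> x" "x \<le> v" "power_series c x = 0"
    using IVT2[of "power_series c" v 0 0] v by auto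
  then show ?thesis
    unfolding P using v power_series_root_unique[of c, OF c1 c(2)]
    by (intro ex1I[of _ x]) auto
qed

text \<open>Decay from the smaller of y and \<gamma> to the larger bounds \<delta> \<bar>y -
  \<gamma>\<bar> by the sum of the absolute values of P_n at both, hence by \<gamma>^n +
  \<gamma>^(n+1) / (1 - \<gamma>).\<close>

lemma approximate_root_close:
  fixes b :: "nat \<Rightarrow> real"
  assumes b: "b 0 = 1" "\<And>j. b j \<in> {-1, 0, 1}"
    and t: "transversality \<delta> \<rho>" "0 < \<delta>" and \<rho>: "\<rho> < 1"
    and \<gamma>: "0 \<le> \<gamma>" "\<gamma> \<le> \<rho>" and root: "power_series b \<gamma> = 0"
    and small: "\<gamma> ^ (n + 1) < \<delta> * (1 - \<gamma>)"
    and y: "0 \<le> y" "y \<le> \<rho>" "\<bar>partial_poly b n y\<bar> \<le> \<gamma> ^ n"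
  shows "\<bar>y - \<gamma>\<bar> \<le> 1 / (\<delta> * (1 - \<gamma>)) * \<gamma> ^ n"
proof -
  have b1: "\<bar>b j\<bar> \<le> 1" for j using b(2)[of j] by auto
  define c where "c j = (if j \<le> n then b j else 0)" for j
  have c: "c j \<in> {-1, 0, 1}" "c 0 = 1" for j using b by (auto simp: c_def)
  have P: "partial_poly b n = power_series c"
    unfolding partial_poly_eq_power_series c_def ..
  have tail: "\<bar>power_series c \<gamma>\<bar> \<le> \<gamma> ^ (n + 1) / (1 - \<gamma>)"
    using power_series_tail[of b, OF b1 \<gamma>(1), of n] \<gamma> \<rho> root P by simp
  also have "\<gamma> ^ (n + 1) / (1 - \<gamma>) < \<delta>"
    using small \<gamma> \<rho> by (subst pos_divide_less_eq) auto
  finally have small': "power_series c \<gamma> < \<delta>" by simp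
  have "\<delta> * \<bar>y - \<gamma>\<bar> \<le> \<gamma> ^ n + \<gamma> ^ (n + 1) / (1 - \<gamma>)"
  proof (cases "\<gamma> \<le> y")
    case True
    then have "power_series c y + \<delta> * (y - \<gamma>) \<le> power_series c \<gamma>"
      by (intro transversality_decay[where c = c, OF t \<rho> c] \<gamma> y small')
    then show ?thesis using True tail y(3) P by simp
  next
    case False
    show ?thesis
    proof (cases "power_series c y < \<delta>")
      case small_y: True
      then have "power_series c \<gamma> + \<delta> * (\<gamma> - y) \<le> power_series c y"
        using False by (intro transversality_decay[where c = c, OF t \<rho> c] \<gamma> y) auto
      then show ?thesis using False tail y(3) P by simp
    next
      \<comment> \<open>Decay cannot start from y, but now \<delta> \<le> P_n(y) \<le> \<gamma>^n,
        and \<bar>y - \<gamma>\<bar> \<le> 1 is enough.\<close>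
      case large_y: False
      have "\<delta> * \<bar>y - \<gamma>\<bar> \<le> \<delta> * 1"
        using t(2) y \<gamma> \<rho> by (intro mult_left_mono) auto
      also have "\<dots> \<le> \<gamma> ^ n" using large_y y(3) P by simp
      also have "\<dots> \<le> \<gamma> ^ n + \<gamma> ^ (n + 1) / (1 - \<gamma>)" using \<gamma> \<rho> by simp
      finally show ?thesis .
    qed
  qed
  also have "\<gamma> ^ n + \<gamma> ^ (n + 1) / (1 - \<gamma>) = \<gamma> ^ n / (1 - \<gamma>)"
    using \<gamma> \<rho> by (simp add: field_simps)
  finally show ?thesis using t(2) \<gamma> \<rho> by (simp add: field_simps)
qed

theorem theorem4p1:
  fixes b :: "nat \<Rightarrow> real"
    and \<gamma> \<gamma>_low \<gamma>_high \<epsilon> \<delta> :: real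
    and N :: int
  assumes "b 0 \<in> {-1, 1}"
    and "\<And>j. j \<ge> 1 \<Longrightarrow> b j \<in> {-1, 0, 1}"
    and "0 < \<gamma>_low" and "\<gamma>_low \<le> \<gamma>_high"
    and "\<epsilon> > 0" and "\<gamma>_high = 0.6491 - \<epsilon>"
    and "\<gamma> \<in> {\<gamma>_low..\<gamma>_high}"
    and "power_series b \<gamma> = 0"
    and "\<delta> > 0" and "transversality \<delta> \<gamma>_high"
    and "\<gamma> powi (N + 1) \<le> \<epsilon> * \<delta> * (1 - \<gamma>)"
    and "\<And>M::int. \<gamma> powi (M + 1) \<le> \<epsilon> * \<delta> * (1 - \<gamma>) \<Longrightarrow> N \<le> M"
  shows "\<forall>n::nat. int n \<ge> N \<longrightarrow>
      (\<exists>!\<gamma>\<^sub>n. \<gamma>\<^sub>n \<in> {0..0.6491} \<and> partial_poly b n \<gamma>\<^sub>n = 0) \<and>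
      (\<forall>\<gamma>'\<in>{\<gamma>_low..\<gamma>_high}. \<bar>partial_poly b n \<gamma>'\<bar> \<le> \<gamma>_low ^ n \<longrightarrow>
        \<bar>\<gamma>' - \<gamma>\<bar> \<le> 1 / (\<delta> * (1 - \<gamma>)) * \<bar>\<gamma>\<bar> ^ n)"
proof (intro allI impI)
  fix n :: nat assume n: "int n \<ge> N"
  have \<gamma>: "0 < \<gamma>" "\<gamma> < 0.6491" "\<gamma> \<le> \<gamma>_high" "\<gamma>_low \<le> \<gamma>" "\<gamma>_high < 1" "\<epsilon> \<le> 0.6491 - \<gamma>" "\<epsilon> < 1"
    using assms(3-7) by auto
  \<comment> \<open>Multiplying by the sign \<open>b 0\<close> normalises the constant term to 1 and
    changes neither roots nor absolute values.\<close>
  define a where "a j = b 0 * b j" for j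
  have a: "a 0 = 1" "a j \<in> {-1, 0, 1}" for j
    using assms(1) assms(2)[of j] by (cases "j = 0"; auto simp: a_def)+
  have "\<bar>b j\<bar> \<le> 1" for j using assms(1) assms(2)[of j] by (cases "j = 0") auto
  moreover have ab: "a = b \<or> a = (\<lambda>j. - b j)"
    using assms(1) by (auto simp: a_def)
  ultimately have root: "power_series a \<gamma> = 0"
    using assms(8) power_series_uminus[of b \<gamma>] \<gamma> by auto
  have P: "partial_poly a n = (\<lambda>x. b 0 * partial_poly b n x)"
    by (simp add: fun_eq_iff partial_poly_def a_def sum_distrib_left mult.assoc)
  have P': "partial_poly b n x = 0 \<longleftrightarrow> partial_poly a n x = 0"
    "\<bar>partial_poly b n x\<bar> = \<bar>partial_poly a n x\<bar>" for x
    using assms(1) by (auto simp: P)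
  have "\<gamma> ^ (n + 1) = \<gamma> powi (int n + 1)"
    by (metis of_nat_1 of_nat_add power_int_of_nat)
  also have "\<dots> \<le> \<gamma> powi (N + 1)"
    using n \<gamma> by (intro power_int_decreasing) auto
  finally have pow: "\<gamma> ^ (n + 1) \<le> \<epsilon> * \<delta> * (1 - \<gamma>)" using assms(11) by simp
  have "\<epsilon> * \<delta> * (1 - \<gamma>) \<le> (0.6491 - \<gamma>) * \<delta> * (1 - \<gamma>)"
    using \<gamma> assms(9) by (intro mult_right_mono) auto
  then have "\<exists>!x. x \<in> {0..0.6491} \<and> partial_poly a n x = 0"
    using \<gamma> pow
    by (intro partial_poly_root_unique_exists[OF a _ _ root transversality_mono[OF assms(10)]]) auto
  \<comment> \<open>Since \<epsilon> < 1, the value of P_n at \<gamma> is strictly below \<delta>,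
    as decay from \<gamma> requires.\<close>
  moreover have "\<epsilon> * \<delta> * (1 - \<gamma>) < 1 * \<delta> * (1 - \<gamma>)"
    using \<gamma> assms(9) by (intro mult_strict_right_mono) auto
  then have small: "\<gamma> ^ (n + 1) < \<delta> * (1 - \<gamma>)" using pow by simp
  have "\<bar>y - \<gamma>\<bar> \<le> 1 / (\<delta> * (1 - \<gamma>)) * \<bar>\<gamma>\<bar> ^ n"
    if y: "y \<in> {\<gamma>_low..\<gamma>_high}" "\<bar>partial_poly b n y\<bar> \<le> \<gamma>_low ^ n" for y
  proof -
    have "\<gamma>_low ^ n \<le> \<gamma> ^ n" using \<gamma> assms(3) by (intro power_mono) auto
    then have "\<bar>y - \<gamma>\<bar> \<le> 1 / (\<delta> * (1 - \<gamma>)) * \<gamma> ^ n"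
      using \<gamma> y assms(3)
      by (intro approximate_root_close[OF a assms(10,9) _ _ _ root small]) (auto simp: P')
    then show ?thesis using \<gamma> by simp
  qed
  ultimately show "(\<exists>!\<gamma>\<^sub>n. \<gamma>\<^sub>n \<in> {0..0.6491} \<and> partial_poly b n \<gamma>\<^sub>n = 0) \<and>
      (\<forall>\<gamma>'\<in>{\<gamma>_low..\<gamma>_high}. \<bar>partial_poly b n \<gamma>'\<bar> \<le> \<gamma>_low ^ n \<longrightarrow>
        \<bar>\<gamma>' - \<gamma>\<bar> \<le> 1 / (\<delta> * (1 - \<gamma>)) * \<bar>\<gamma>\<bar> ^ n)"
    unfolding P'(1) by blast
qed

end
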